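(* Let $X, Y \subset \mathbb{R}$ and let $f : X \to Y$ be a monotonic, injective and continuous function. Let $A$ be an LR-type fuzzy number whose shape functions $L$ and $R$ are injective, with $[A]^0 \subset X$, and let $B$ be a fuzzy number that is $f$-correlated to $A$ (that is, $A$ and $B$ are $f$-correlated). Then for every $\alpha \in [0,1]$, the endpoints of the interval $[B]^{\alpha}$ are the images under $f$ of the endpoints of the interval $[A]^{\alpha}$; that is, writing $[A]^{\alpha} = [l_\alpha, r_\alpha]$, one has $[B]^{\alpha} = [\min\{f(l_\alpha), f(r_\alpha)\}, \max\{f(l_\alpha), f(r_\alpha)\}]$.
   Context: A fuzzy subset $A$ of a topological space $U$ (here $U=\mathbb{R}$ or $\mathbb{R}^2$) is given by its membership function $\varphi_A : U \to [0,1]$; one also writes $A(u)$ for $\varphi_A(u)$. For $\alpha \in (0,1]$ its $\alpha$-level is $[A]^{\alpha} = \{u \in U : \varphi_A(u) \ge \alpha\}$, and $[A]^0 = \overline{\{u \in U : \varphi_A(u) > 0\}}$ is the closure of the support. A fuzzy number is a fuzzy subset $A$ of $\mathbb{R}$ such that, for every $\alpha \in [0,1]$, $[A]^{\alpha}$ is a non-empty bounded closed interval of $\mathbb{R}$. A fuzzy number $A$ is of LR-type if there exist real numbers $q_- \le q_+$, $a, b > 0$, and non-increasing continuous functions $L, R : [0,1] \to [0,1]$ (the shape functions) with $L(0)=R(0)=1$ and $L(1)=R(1)=0$, such that $A(u) = L\left(\frac{q_- - u}{a}\right)$ for $u \in [q_- - a, q_-]$, $A(u) = 1$ for $u \in [q_-,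 q_+]$, $A(u) = R\left(\frac{u - q_+}{b}\right)$ for $u \in [q_+, q_+ + b]$, and $A(u) = 0$ otherwise. A fuzzy subset $J$ of $\mathbb{R}^2$ is a joint possibility distribution of fuzzy numbers $A$ and $B$ if $\max_{y \in \mathbb{R}} \varphi_J(x,y) = \varphi_A(x)$ for all $x \in \mathbb{R}$ and $\max_{x \in \mathbb{R}} \varphi_J(x,y) = \varphi_B(y)$ for all $y \in \mathbb{R}$. For a monotonic, injective and continuous function $f : X \to Y$ with $X, Y \subset \mathbb{R}$, two fuzzy numbers $A$ and $B$ are $f$-correlated if they have a joint possibility distribution $J$ given by $\varphi_J(x,y) = \varphi_A(x)\, \chi_{y=f(x)}(x,y) = \varphi_B(y)\, \chi_{y=f(x)}(x,y)$ for all $(x,y) \in \mathbb{R}^2$, where $\chi_{y=f(x)}$ is the characteristic function of the graph $\{(x,y) \in \mathbb{R}^2 : x \in X,\ y = f(x)\}$. *)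

theory Defs
  imports "HOL-Analysis.Analysis"
begin

text \<open>Fuzzy subsets are represented by their membership functions.\<close>

definition fuzzy_subset :: "('a::topological_space \<Rightarrow> real) \<Rightarrow> bool" where
  "fuzzy_subset A \<longleftrightarrow> (\<forall>u. A u \<in> {0..1})"

definition level :: "('a::topological_space \<Rightarrow> real) \<Rightarrow> real \<Rightarrow> 'a set" where
  "level A \<alpha> = (if \<alpha> = 0 then closure {u. A u > 0} else {u. A u \<ge> \<alpha>})"

definition fuzzy_number :: "(real \<Rightarrow> real) \<Rightarrow> bool" where
  "fuzzy_number A \<longleftrightarrow> fuzzy_subset A \<and> (\<forall>\<alpha>\<in>{0..1}. \<exists>l r. l \<le> r \<and> level A \<alpha> = {l..r})"

text \<open>Only the values of a shape function on \<open>{0..1}\<close> are relevant.\<close>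

definition shape_function :: "(real \<Rightarrow> real) \<Rightarrow> bool" where
  "shape_function S \<longleftrightarrow>
     S \<in> {0..1} \<rightarrow> {0..1} \<and> antimono_on {0..1} S \<and> continuous_on {0..1} S \<and> S 0 = 1 \<and> S 1 = 0"

definition LR_type :: "(real \<Rightarrow> real) \<Rightarrow> (real \<Rightarrow> real) \<Rightarrow> (real \<Rightarrow> real) \<Rightarrow> bool" where
  "LR_type L R A \<longleftrightarrow>
     fuzzy_number A \<and> shape_function L \<and> shape_function R \<and>
     (\<exists>qm qp a b. qm \<le> qp \<and> a > 0 \<and> b > 0 \<and>
        (\<forall>u\<in>{qm - a..qm}. A u = L ((qm - u) / a)) \<and>
        (\<forall>u\<in>{qm..qp}. A u = 1) \<and>
        (\<forall>u\<in>{qp..qp + b}. A u = R ((u - qp) / b)) \<and>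
        (\<forall>u. u \<notin> {qm - a..qp + b} \<longrightarrow> A u = 0))"

text \<open>\<open>Max\<close> is only meaningful for finite sets, so an attained maximum of an arbitrary set
  is expressed as a relation.\<close>

definition is_maximum :: "real set \<Rightarrow> real \<Rightarrow> bool" where
  "is_maximum S m \<longleftrightarrow> m \<in> S \<and> (\<forall>s\<in>S. s \<le> m)"

definition joint_possibility_distribution ::
  "(real \<times> real \<Rightarrow> real) \<Rightarrow> (real \<Rightarrow> real) \<Rightarrow> (real \<Rightarrow> real) \<Rightarrow> bool" where
  "joint_possibility_distribution J A B \<longleftrightarrow>
     fuzzy_subset J \<and>
     (\<forall>x. is_maximum (range (\<lambda>y. J (x, y))) (A x)) \<and>
     (\<forall>y. is_maximum (range (\<lambda>x. J (x, y))) (B y))"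

definition f_correlated ::
  "real set \<Rightarrow> (real \<Rightarrow> real) \<Rightarrow> (real \<Rightarrow> real) \<Rightarrow> (real \<Rightarrow> real) \<Rightarrow> bool" where
  "f_correlated X f A B \<longleftrightarrow>
     (\<exists>J. joint_possibility_distribution J A B \<and>
        (\<forall>x y. J (x, y) = A x * indicator {(x, y). x \<in> X \<and> y = f x} (x, y) \<and>
               J (x, y) = B y * indicator {(x, y). x \<in> X \<and> y = f x} (x, y)))"

end

theory Submission
  imports Defs
begin

text \<open>The joint possibility distribution of \<open>f\<close>-correlated fuzzy numbers lives on the graph of \<open>f\<close>,
  so \<open>B\<close> is the transport of \<open>A\<close> along \<open>f\<close>: it takes the value \<open>A x\<close> at \<open>f x\<close>, and it vanishes
  wherever it does not inherit a positive value in this way (\<open>f_correlated_transport\<close>,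
  \<open>f_correlated_positive_preimage\<close>). Hence \<open>f\<close> maps every superlevel set \<open>{u. A u \<ge> \<alpha>}\<close> with
  \<open>\<alpha> > 0\<close>, and also the open support \<open>{u. A u > 0}\<close>, onto the corresponding set of \<open>B\<close>. For
  \<open>\<alpha> = 0\<close> a closure is taken, and it commutes with \<open>f\<close> because the closed support of \<open>A\<close> is
  compact. So \<open>[B]\<^sup>\<alpha>\<close> is the image of \<open>[A]\<^sup>\<alpha>\<close> under \<open>f\<close> for every \<open>\<alpha>\<close> (\<open>f_correlated_level\<close>).
  By the intermediate value theorem, a continuous monotone function maps a compact interval onto
  the interval spanned by the images of its endpoints.\<close>

lemma monotone_continuous_image_Icc:
  fixes f :: "real \<Rightarrow> real"
  assumes "l \<le> r" "continuous_on {l..r} f"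
    and "mono_on {l..r} f \<or> antimono_on {l..r} f"
  shows "f ` {l..r} = {min (f l) (f r)..max (f l) (f r)}"
  using assms(3)
proof
  assume mono: "mono_on {l..r} f"
  have le: "f l \<le> f x" "f x \<le> f r" if "x \<in> {l..r}" for x
    using that assms(1) by (auto intro!: mono_onD[OF mono])
  have "\<exists>x\<in>{l..r}. f x = y" if "y \<in> {f l..f r}" for y
    using IVT'[of f l y r] assms(1,2) that by auto
  then have "f ` {l..r} = {f l..f r}"
    using le by fastforce
  then show ?thesis
    using le(2)[of l] assms(1) by simp
next
  assume anti: "antimono_on {l..r} f"
  have le: "f r \<le> f x" "f x \<le> f l" if "x \<in> {l..r}" for x
    using that assms(1) by (auto intro!: monotone_onD[OF anti])
  have "\<exists>x\<in>{l..r}. f x = y" if "y \<in> {f r..f l}" for y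
    using IVT2'[of f r y l] assms(1,2) that by auto
  then have "f ` {l..r} = {f r..f l}"
    using le by fastforce
  then show ?thesis
    using le(1)[of l] assms(1) by simp
qed

lemma closure_continuous_image_compact:
  fixes f :: "'a::metric_space \<Rightarrow> 'b::metric_space"
  assumes "compact (closure S)" "continuous_on (closure S) f"
  shows "closure (f ` S) = f ` closure S"
proof
  have "closed (f ` closure S)"
    by (intro compact_imp_closed compact_continuous_image assms)
  then show "closure (f ` S) \<subseteq> f ` closure S"
    by (intro closure_minimal image_mono closure_subset)
  show "f ` closure S \<subseteq> closure (f ` S)"
    by (intro image_closure_subset[OF assms(2)] closed_closure closure_subset)
qed

text \<open>Both expressions for the joint distribution are evaluated at the point \<open>(x, f x)\<close> of the
  graph, where the characteristic function is \<open>1\<close>.\<close>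

lemma f_correlated_transport:
  assumes "f_correlated X f A B" "x \<in> X"
  shows "B (f x) = A x"
proof -
  obtain J where J: "\<And>x y. J (x, y) = A x * indicator {(x, y). x \<in> X \<and> y = f x} (x, y)"
      "\<And>x y. J (x, y) = B y * indicator {(x, y). x \<in> X \<and> y = f x} (x, y)"
    using assms(1) unfolding f_correlated_def by blast
  show ?thesis
    using J(1)[of x "f x"] J(2)[of x "f x"] assms(2) by simp
qed

text \<open>The value \<open>B y\<close> is attained as a maximum over the line of height \<open>y\<close>, and a positive
  value of the joint distribution is only attained on the graph.\<close>

lemma f_correlated_positive_preimage:
  assumes "f_correlated X f A B" "B y > 0"
  obtains x where "x \<in> X" "y = f x"
proof -
  obtain J where J: "joint_possibility_distribution J A B"
      "\<And>x y. J (x, y) = B y * indicator {(x, y). x \<in> X \<and> y = f x} (x, y)"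
    using assms(1) unfolding f_correlated_def by blast
  obtain x where "B y = J (x, y)"
    using J(1) unfolding joint_possibility_distribution_def is_maximum_def by blast
  then show thesis
    using J(2)[of x y] assms(2) that by (auto simp: indicator_def split: if_splits)
qed

text \<open>The predicate \<open>P\<close> covers the conditions \<open>t \<ge> \<alpha>\<close> with \<open>\<alpha> > 0\<close> and \<open>t > 0\<close> at once. It has to
  imply positivity, since off the range of \<open>f\<close> the value of \<open>B\<close> is \<open>0\<close>.\<close>

lemma f_correlated_image_positive:
  assumes "f_correlated X f A B" "{u. A u > 0} \<subseteq> X" "\<And>t. P t \<Longrightarrow> t > 0"
  shows "{v. P (B v)} = f ` {u. P (A u)}"
proof (intro subset_antisym subsetI)
  fix v assume "v \<in> {v. P (B v)}"
  then have "P (B v)" by simp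
  moreover obtain x where "x \<in> X" "v = f x"
    using f_correlated_positive_preimage[OF assms(1) assms(3)] \<open>P (B v)\<close> by blast
  ultimately show "v \<in> f ` {u. P (A u)}"
    using f_correlated_transport[OF assms(1)] by auto
next
  fix v assume "v \<in> f ` {u. P (A u)}"
  then obtain u where u: "P (A u)" "v = f u" by auto
  then have "u \<in> X"
    using assms(2,3) by auto
  then show "v \<in> {v. P (B v)}"
    using u f_correlated_transport[OF assms(1)] by simp
qed

lemma level_subset_level_0:
  assumes "\<alpha> \<ge> 0"
  shows "level A \<alpha> \<subseteq> level A 0"
proof (cases "\<alpha> = 0")
  case False
  then have "level A \<alpha> \<subseteq> {u. A u > 0}"
    using assms by (auto simp: level_def)
  then show ?thesis
    using closure_subset by (fastforce simp: level_def)
qed simp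

theorem f_correlated_level:
  fixes f :: "real \<Rightarrow> real"
  assumes corr: "f_correlated X f A B" and "continuous_on X f" "level A 0 \<subseteq> X"
    and "\<alpha> \<ge> 0" "compact (level A \<alpha>)"
  shows "level B \<alpha> = f ` level A \<alpha>"
proof -
  have supp: "{u. A u > 0} \<subseteq> X"
    using assms(3) closure_subset by (fastforce simp: level_def)
  show ?thesis
  proof (cases "\<alpha> = 0")
    case True
    have "{v. B v > 0} = f ` {u. A u > 0}"
      by (rule f_correlated_image_positive[OF corr supp])
    moreover have "closure (f ` {u. A u > 0}) = f ` closure {u. A u > 0}"
      using assms True
      by (intro closure_continuous_image_compact)
        (auto simp: level_def intro: continuous_on_subset)
    ultimately show ?thesis
      using True by (simp add: level_def)
  next
    case False
    then have "{v. B v \<ge> \<alpha>} = f ` {u. A u \<ge> \<alpha>}"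
      using \<open>\<alpha> \<ge> 0\<close> by (intro f_correlated_image_positive[OF corr supp]) auto
    then show ?thesis
      using False by (simp add: level_def)
  qed
qed

theorem theorem1:
  fixes X Y :: "real set" and f A B L R :: "real \<Rightarrow> real"
  assumes "f \<in> X \<rightarrow> Y"
    and "mono_on X f \<or> antimono_on X f"
    and "inj_on f X"
    and "continuous_on X f"
    and "LR_type L R A"
    and "inj_on L {0..1}"
    and "inj_on R {0..1}"
    and "level A 0 \<subseteq> X"
    and "fuzzy_number B"
    and "f_correlated X f A B"
  shows "\<forall>\<alpha>\<in>{0..1}. \<forall>l r. l \<le> r \<and> level A \<alpha> = {l..r} \<longrightarrow>
           level B \<alpha> = {min (f l) (f r)..max (f l) (f r)}"
proof (intro ballI allI impI)
  fix \<alpha> l r :: real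
  assume "\<alpha> \<in> {0..1}" and lr: "l \<le> r \<and> level A \<alpha> = {l..r}"
  then have sub: "{l..r} \<subseteq> X"
    using level_subset_level_0[of \<alpha> A] assms(8) by auto
  have "level B \<alpha> = f ` {l..r}"
    using f_correlated_level[OF assms(10,4,8), of \<alpha>] lr \<open>\<alpha> \<in> {0..1}\<close> by simp
  also have "\<dots> = {min (f l) (f r)..max (f l) (f r)}"
    using lr sub assms(2,4)
    by (intro monotone_continuous_image_Icc)
      (auto intro: continuous_on_subset monotone_on_subset)
  finally show "level B \<alpha> = {min (f l) (f r)..max (f l) (f r)}" .
qed

end
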